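(* Let $(M,\tau)$ be a von Neumann algebra with a faithful normal tracial state, let $n\ge3$, let $u_1,\dots,u_n\in M$ be unitaries and $a=a^*\in M$, such that $u_1,\dots,u_n,a$ are freely independent with respect to $\tau$, $\tau(u_j)=0$ for all $j$, $\tau(a)=0$, $\tau(a^2)=1$ and $a^2\neq1$. Put $a_j=au_j$ for $1\le j\le n$. Then $$\mathbb{E}_{\mathrm{wo},3}=\frac1{n(n-1)(n-2)}\sum_{\substack{1\le j_1,j_2,j_3\le n\\ \text{all different}}}a_{j_1}a_{j_2}a_{j_3}a_{j_3}^*a_{j_2}^*a_{j_1}^*,\qquad \mathbb{E}_{\mathrm{wr},3}=\frac1{n^3}\sum_{j_1,j_2,j_3=1}^na_{j_1}a_{j_2}a_{j_3}a_{j_3}^*a_{j_2}^*a_{j_1}^*$$ do not satisfy $\mathbb{E}_{\mathrm{wo},3}\le\mathbb{E}_{\mathrm{wr},3}$.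
   Context: Free independence of $u_1,\dots,u_n,a$ means that the von Neumann subalgebras generated by each of these elements are free in $(M,\tau)$: $\tau(c_1c_2\cdots c_m)=0$ whenever each $c_i$ is a $\tau$-centered element ($\tau(c_i)=0$) of one of these subalgebras and consecutive $c_i,c_{i+1}$ come from different subalgebras. The inequality $\le$ is the usual order on self-adjoint operators. *)

theory Defs
  imports "HOL-Analysis.Analysis"
begin

section \<open>Complex Hilbert spaces\<close>

class complex_vector = real_vector +
  fixes scaleC :: "complex \<Rightarrow> 'a \<Rightarrow> 'a" (infixr "*\<^sub>C" 75)
  assumes scaleC_add_right: "c *\<^sub>C (x + y) = c *\<^sub>C x + c *\<^sub>C y"
    and scaleC_add_left: "(c + d) *\<^sub>C x = c *\<^sub>C x + d *\<^sub>C x"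
    and scaleC_scaleC: "c *\<^sub>C (d *\<^sub>C x) = (c * d) *\<^sub>C x"
    and scaleC_one: "1 *\<^sub>C x = x"
    and scaleR_scaleC: "r *\<^sub>R x = complex_of_real r *\<^sub>C x"

text \<open>The complex inner product is conjugate-linear in its first argument. Its real part is the
  inner product of the underlying real space; with the Hermitian symmetry this gives
  \<open>cinner x x = (norm x)\<^sup>2\<close>, so positivity and definiteness are inherited from
  \<^class>\<open>real_inner\<close>.\<close>

class complex_inner = complex_vector + real_inner +
  fixes cinner :: "'a \<Rightarrow> 'a \<Rightarrow> complex"
  assumes cinner_commute: "cinner x y = cnj (cinner y x)"
    and cinner_add_right: "cinner x (y + z) = cinner x y + cinner x z"
    and cinner_scaleC_right: "cinner x (c *\<^sub>C y) = c * cinner x y"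
    and Re_cinner: "Re (cinner x y) = inner x y"

class chilbert_space = complex_inner + complete_space

lemma cinner_self: "cinner x x = complex_of_real ((norm x)\<^sup>2)"
proof (rule complex_eqI)
  show "Im (cinner x x) = Im (complex_of_real ((norm x)\<^sup>2))"
    using arg_cong[OF cinner_commute[of x x], of Im] by simp
qed (simp add: Re_cinner power2_norm_eq_inner)

lemma cinner_add_left: "cinner (x + y) z = cinner x z + cinner y z"
  by (metis cinner_add_right cinner_commute complex_cnj_add)

lemma cinner_scaleC_left: "cinner (c *\<^sub>C x) y = cnj c * cinner x y"
  by (metis cinner_commute cinner_scaleC_right complex_cnj_mult)

lemma Im_cinner: "Im (cinner x y) = inner (\<i> *\<^sub>C x) y"
  by (simp flip: Re_cinner add: cinner_scaleC_left)

lemma cinner_eqI: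
  assumes "\<And>z. cinner x z = cinner y z"
  shows "x = y"
  using assms by (metis Re_cinner inner_commute vector_eq_rdot)

lemma scaleC_minus_one: "(- 1) *\<^sub>C x = - (x::'a::complex_vector)"
  by (metis of_real_1 of_real_minus scaleR_minus1_left scaleR_scaleC)

section \<open>Bounded operators\<close>

typedef (overloaded) ('a::chilbert_space) bounded_op =
  "{T :: 'a \<Rightarrow> 'a. bounded_linear T \<and> (\<forall>c x. T (c *\<^sub>C x) = c *\<^sub>C T x)}"
  morphisms op_apply Bounded_Op
  by (rule exI[of _ "\<lambda>x. x"]) (simp add: bounded_linear_ident)

setup_lifting type_definition_bounded_op

lemma op_eqI: "(\<And>x. op_apply S x = op_apply T x) \<Longrightarrow> S = T"
  by (metis ext op_apply_inject)

lemma bounded_linear_op_apply: "bounded_linear (op_apply T)"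
  and op_apply_scaleC: "op_apply T (c *\<^sub>C x) = c *\<^sub>C op_apply T x"
  using op_apply[of T] by auto

instantiation bounded_op :: (chilbert_space) complex_vector
begin

lift_definition zero_bounded_op :: "'a bounded_op" is "\<lambda>x. 0"
  by (auto simp: bounded_linear_zero) (metis add_cancel_right_left scaleC_add_right)

lift_definition plus_bounded_op :: "'a bounded_op \<Rightarrow> 'a bounded_op \<Rightarrow> 'a bounded_op"
  is "\<lambda>S T x. S x + T x"
  by (auto simp: bounded_linear_add scaleC_add_right)

lift_definition uminus_bounded_op :: "'a bounded_op \<Rightarrow> 'a bounded_op"
  is "\<lambda>T x. - T x"
  by (auto simp: bounded_linear_minus) (metis mult.commute scaleC_minus_one scaleC_scaleC)

lift_definition minus_bounded_op :: "'a bounded_op \<Rightarrow> 'a bounded_op \<Rightarrow> 'a bounded_op"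
  is "\<lambda>S T x. S x - T x"
  by (auto simp: bounded_linear_sub)
     (metis add_diff_cancel_right' diff_add_cancel scaleC_add_right)

lift_definition scaleC_bounded_op :: "complex \<Rightarrow> 'a bounded_op \<Rightarrow> 'a bounded_op"
  is "\<lambda>c T x. c *\<^sub>C T x"
proof safe
  fix c :: complex and T :: "'a \<Rightarrow> 'a"
  assume T: "bounded_linear T" and TC: "\<forall>c x. T (c *\<^sub>C x) = c *\<^sub>C T x"
  interpret T: bounded_linear T by (rule T)
  obtain K where K: "\<And>x. norm (T x) \<le> norm x * K" using T.bounded by blast
  have nrm: "norm (c *\<^sub>C x) = cmod c * norm x" for x :: 'a
  proof -
    have "complex_of_real ((norm (c *\<^sub>C x))\<^sup>2) = (cnj c * c) * cinner x x"
      unfolding cinner_self[symmetric] by (simp add: cinner_scaleC_left cinner_scaleC_right)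
    also have "\<dots> = complex_of_real ((cmod c * norm x)\<^sup>2)"
      by (simp only: cinner_self power_mult_distrib of_real_mult
          complex_norm_square mult.commute[of "cnj c" c])
    finally show ?thesis
      by (metis norm_ge_zero of_real_eq_iff power2_eq_imp_eq zero_le_mult_iff)
  qed
  show "bounded_linear (\<lambda>x. c *\<^sub>C T x)"
  proof (rule bounded_linear_intro)
    show "norm (c *\<^sub>C T x) \<le> norm x * (cmod c * K)" for x
      using mult_left_mono[OF K[of x], of "cmod c"] by (simp add: nrm algebra_simps)
  qed (simp_all add: T.add T.scaleR scaleC_add_right TC scaleR_scaleC scaleC_scaleC mult.commute)
  show "c *\<^sub>C T (d *\<^sub>C x) = d *\<^sub>C c *\<^sub>C T x" for d x
    by (simp add: TC scaleC_scaleC mult.commute)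
qed

definition scaleR_bounded_op :: "real \<Rightarrow> 'a bounded_op \<Rightarrow> 'a bounded_op" where
  "scaleR_bounded_op r T = complex_of_real r *\<^sub>C T"

instance
proof
  fix r s :: real and c d :: complex and S T U :: "'a bounded_op"
  show "S + T + U = S + (T + U)" by transfer (simp add: add.assoc)
  show "S + T = T + S" by transfer (simp add: add.commute)
  show "0 + T = T" by transfer simp
  show "- T + T = 0" by transfer simp
  show "S - T = S + - T" by transfer simp
  show C1: "c *\<^sub>C (S + T) = c *\<^sub>C S + c *\<^sub>C T" for c and S T :: "'a bounded_op"
    by transfer (simp add: scaleC_add_right)
  show C2: "(c + d) *\<^sub>C T = c *\<^sub>C T + d *\<^sub>C T" for c d and T :: "'a bounded_op"
    by transfer (simp add: scaleC_add_left)
  show C3: "c *\<^sub>C d *\<^sub>C T = (c * d) *\<^sub>C T" for c d and T :: "'a bounded_op"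
    by transfer (simp add: scaleC_scaleC)
  show C4: "1 *\<^sub>C T = T" for T :: "'a bounded_op"
    by transfer (simp add: scaleC_one)
  show "r *\<^sub>R T = complex_of_real r *\<^sub>C T" by (simp add: scaleR_bounded_op_def)
  show "r *\<^sub>R (S + T) = r *\<^sub>R S + r *\<^sub>R T" by (simp add: scaleR_bounded_op_def C1)
  show "(r + s) *\<^sub>R T = r *\<^sub>R T + s *\<^sub>R T" by (simp add: scaleR_bounded_op_def C2)
  show "r *\<^sub>R s *\<^sub>R T = (r * s) *\<^sub>R T" by (simp add: scaleR_bounded_op_def C3)
  show "1 *\<^sub>R T = T" by (simp add: scaleR_bounded_op_def C4)
qed

end

text \<open>The product of operators is composition. The class \<open>ring_1\<close> is out of reach since
  \<open>0 = 1\<close> on the zero space.\<close>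

instantiation bounded_op :: (chilbert_space) "{ring, monoid_mult}"
begin

lift_definition one_bounded_op :: "'a bounded_op" is "\<lambda>x. x"
  by (simp add: bounded_linear_ident)

lift_definition times_bounded_op :: "'a bounded_op \<Rightarrow> 'a bounded_op \<Rightarrow> 'a bounded_op"
  is "\<lambda>S T x. S (T x)"
  by (auto intro: bounded_linear_compose)

instance
  by standard (transfer; auto simp: linear_add bounded_linear.linear)+

end

section \<open>Adjoints and the operator order\<close>

lemma riesz_real:
  fixes g :: "'a::{real_inner,complete_space} \<Rightarrow> real"
  assumes "bounded_linear g"
  shows "\<exists>x. \<forall>y. g y = inner x y"
proof -
  interpret g: bounded_linear g by fact
  obtain K where K: "\<And>x. norm (g x) \<le> norm x * K" using g.bounded by blast
  define J where "J x = (norm x)\<^sup>2 - 2 * g x" for x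
  have lower: "- K\<^sup>2 \<le> J x" for x
  proof -
    have "0 \<le> (norm x - K)\<^sup>2" by simp
    then have "2 * (norm x * K) - K\<^sup>2 \<le> (norm x)\<^sup>2" by (simp add: power2_diff algebra_simps)
    then show ?thesis using K[of x] by (simp add: J_def abs_le_iff)
  qed
  then have bdd: "bdd_below (range J)" by (auto intro!: bdd_belowI)
  define m where "m = Inf (range J)"
  have m_le: "m \<le> J x" for x unfolding m_def by (rule cInf_lower[OF _ bdd]) simp
  have "\<exists>x. J x < m + inverse (real (Suc k))" for k
    using cInf_lessD[of "range J" "m + inverse (real (Suc k))"] by (auto simp: m_def)
  then obtain s where s: "\<And>k. J (s k) < m + inverse (real (Suc k))" by metis
  have near: "(norm (x - y))\<^sup>2 \<le> 2 * (J x - m) + 2 * (J y - m)" for x y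
  proof -
    have "(norm (x - y))\<^sup>2 = 2 * J x + 2 * J y - 4 * J ((1/2) *\<^sub>R (x + y))"
      by (simp add: J_def g.scaleR g.add power2_norm_eq_inner inner_add inner_diff
          inner_commute algebra_simps)
    then show ?thesis using m_le[of "(1/2) *\<^sub>R (x + y)"] by simp
  qed
  have "Cauchy s"
  proof (rule metric_CauchyI)
    fix e :: real assume e: "0 < e"
    obtain N where N: "inverse (real (Suc N)) < e\<^sup>2 / 4"
      using reals_Archimedean[of "e\<^sup>2 / 4"] e by auto
    have small: "J (s k) - m < e\<^sup>2 / 4" if "N \<le> k" for k
    proof -
      have "inverse (real (Suc k)) \<le> inverse (real (Suc N))"
        using that by (intro le_imp_inverse_le) auto
      then show ?thesis using s[of k] N by linarith
    qed
    have "dist (s k) (s l) < e" if "N \<le> k" "N \<le> l" for k l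
    proof -
      have "(norm (s k - s l))\<^sup>2 < e\<^sup>2"
        using near[of "s k" "s l"] small[OF that(1)] small[OF that(2)] by argo
      then show ?thesis using e power_less_imp_less_base[of _ 2 e] by (auto simp: dist_norm)
    qed
    then show "\<exists>N. \<forall>k\<ge>N. \<forall>l\<ge>N. dist (s k) (s l) < e" by blast
  qed
  then obtain x where x: "s \<longlonglongrightarrow> x"
    using Cauchy_convergent_iff convergent_def by blast
  have "(\<lambda>k. J (s k)) \<longlonglongrightarrow> J x"
    unfolding J_def by (intro tendsto_intros g.tendsto x)
  moreover have "(\<lambda>k. m + inverse (real (Suc k))) \<longlonglongrightarrow> m + 0"
    by (intro tendsto_intros LIMSEQ_inverse_real_of_nat)
  ultimately have Jx: "J x \<le> m + 0"
    using s by (intro LIMSEQ_le) (auto intro: less_imp_le)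
  have "g y = inner x y" for y
  proof -
    define d where "d = inner x y - g y"
    define N where "N = (norm y)\<^sup>2 + 1"
    have N: "0 < N" by (simp add: N_def add_nonneg_pos)
    have "J (x + t *\<^sub>R y) = J x + (2 * t * d + t\<^sup>2 * (norm y)\<^sup>2)" for t
      unfolding J_def d_def power2_norm_eq_inner
      by (simp add: g.scaleR g.add inner_add inner_commute power2_eq_square algebra_simps)
    from this[of "- d / N"]
    have "0 \<le> 2 * (- d / N) * d + (- d / N)\<^sup>2 * (norm y)\<^sup>2"
      using Jx m_le[of "x + (- d / N) *\<^sub>R y"] by linarith
    also have "\<dots> = d\<^sup>2 * ((norm y)\<^sup>2 - 2 * N) / N\<^sup>2"
      using N by (simp add: field_simps power2_eq_square)
    finally have "0 \<le> d\<^sup>2 * ((norm y)\<^sup>2 - 2 * N)"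
      using N by (simp add: zero_le_divide_iff)
    moreover have "(norm y)\<^sup>2 - 2 * N < 0"
      using N N_def by linarith
    ultimately have "d = 0"
      by (metis mult_pos_neg not_le zero_less_power2)
    then show ?thesis by (simp add: d_def)
  qed
  then show ?thesis by blast
qed

definition adj :: "'a::chilbert_space bounded_op \<Rightarrow> 'a bounded_op" where
  "adj T = (THE S. \<forall>x y. cinner (op_apply S x) y = cinner x (op_apply T y))"

lemma adjoint_exists:
  fixes T :: "'a::chilbert_space bounded_op"
  shows "\<exists>S. \<forall>x y. cinner (op_apply S x) y = cinner x (op_apply T y)"
proof -
  interpret T: bounded_linear "op_apply T" by (rule bounded_linear_op_apply)
  have "\<exists>z. \<forall>y. inner x (op_apply T y) = inner z y" for x
    by (rule riesz_real) (rule bounded_linear_inner_right_comp[OF T.bounded_linear_axioms])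
  then obtain f where f: "\<And>x y. inner x (op_apply T y) = inner (f x) y" by metis
  have fC: "cinner (f x) y = cinner x (op_apply T y)" for x y
  proof -
    have sw: "inner (\<i> *\<^sub>C p) q = - inner p (\<i> *\<^sub>C q)" for p q :: 'a
      by (simp flip: Re_cinner add: cinner_scaleC_left cinner_scaleC_right)
    show ?thesis
      by (rule complex_eqI)
         (simp_all add: Re_cinner f Im_cinner sw op_apply_scaleC flip: f)
  qed
  have add: "f (x + y) = f x + f y" for x y
    by (rule cinner_eqI) (simp add: fC cinner_add_left)
  have sc: "f (c *\<^sub>C x) = c *\<^sub>C f x" for c x
    by (rule cinner_eqI) (simp add: fC cinner_scaleC_left)
  obtain K where K: "\<And>x. norm (op_apply T x) \<le> norm x * K" using T.bounded by blast
  have "bounded_linear f"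
  proof (rule bounded_linear_intro)
    fix x
    have "norm (f x) * norm (f x) = inner x (op_apply T (f x))"
      by (simp add: f flip: power2_eq_square power2_norm_eq_inner)
    also have "\<dots> \<le> norm x * norm (op_apply T (f x))" by (rule norm_cauchy_schwarz)
    also have "\<dots> \<le> norm x * (norm (f x) * K)" by (intro mult_left_mono K) simp
    finally have *: "norm (f x) * norm (f x) \<le> norm (f x) * (norm x * K)"
      by (simp add: algebra_simps)
    show "norm (f x) \<le> norm x * K"
    proof (cases "f x = 0")
      case True
      have "0 \<le> norm x * K" using K[of x] norm_ge_zero order_trans by blast
      then show ?thesis using True by simp
    qed (use * in simp)
  qed (simp_all add: add sc scaleR_scaleC)
  then have "op_apply (Bounded_Op f) = f" using sc by (simp add: Bounded_Op_inverse)
  then show ?thesis using fC by metis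
qed

lemma cinner_adj: "cinner (op_apply (adj T) x) y = cinner x (op_apply T y)"
proof -
  have "\<exists>!S. \<forall>x y. cinner (op_apply S x) y = cinner x (op_apply T y)"
    using adjoint_exists[of T] by (metis cinner_eqI op_eqI)
  from theI'[OF this] show ?thesis unfolding adj_def by blast
qed

definition positive_op :: "'a::chilbert_space bounded_op \<Rightarrow> bool" where
  "positive_op T \<longleftrightarrow> adj T = T \<and> (\<forall>x. 0 \<le> Re (cinner x (op_apply T x)))"

definition unitary_op :: "'a::chilbert_space bounded_op \<Rightarrow> bool" where
  "unitary_op U \<longleftrightarrow> adj U * U = 1 \<and> U * adj U = 1"

lemma op_apply_add: "op_apply (S + T) x = op_apply S x + op_apply T x"
  and op_apply_diff: "op_apply (S - T) x = op_apply S x - op_apply T x"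
  and op_apply_zero: "op_apply 0 x = 0"
  by (transfer; simp)+

lemma adj_add: "adj (S + T) = adj S + adj T"
  by (intro op_eqI cinner_eqI)
     (simp add: cinner_adj op_apply_add cinner_add_left cinner_add_right)

instantiation bounded_op :: (chilbert_space) order
begin

definition less_eq_bounded_op :: "'a bounded_op \<Rightarrow> 'a bounded_op \<Rightarrow> bool" where
  "S \<le> T \<longleftrightarrow> positive_op (T - S)"

definition less_bounded_op :: "'a bounded_op \<Rightarrow> 'a bounded_op \<Rightarrow> bool" where
  "S < T \<longleftrightarrow> S \<le> T \<and> \<not> T \<le> S" for S T :: "'a bounded_op"

instance
proof
  fix S T U :: "'a bounded_op"
  show "(S < T) = (S \<le> T \<and> \<not> T \<le> S)" by (rule less_bounded_op_def)
  have "adj 0 = (0 :: 'a bounded_op)" using adj_add[of "0 :: 'a bounded_op" 0] by simp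
  then show "S \<le> S"
    by (simp add: less_eq_bounded_op_def positive_op_def op_apply_zero Re_cinner)
  show "S \<le> U" if "S \<le> T" "T \<le> U"
  proof -
    have "U - S = (U - T) + (T - S)" by simp
    then show ?thesis using that
      by (simp only: less_eq_bounded_op_def positive_op_def adj_add op_apply_add
          cinner_add_right plus_complex.sel add_nonneg_nonneg simp_thms)
  qed
  show "S = T" if ST: "S \<le> T" and TS: "T \<le> S"
  proof -
    define A where "A = op_apply (T - S)"
    have sa: "inner (A x) y = inner x (A y)" for x y
      using ST cinner_adj[of "T - S" x y]
      unfolding A_def by (simp add: less_eq_bounded_op_def positive_op_def flip: Re_cinner)
    interpret A: bounded_linear A unfolding A_def by (rule bounded_linear_op_apply)
    have z: "inner x (A x) = 0" for x
      using ST TS unfolding A_def less_eq_bounded_op_def positive_op_def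
      by (simp add: Re_cinner op_apply_diff inner_diff_right)
         (metis antisym)
    have "inner (x + A x) (A (x + A x)) = 2 * (norm (A x))\<^sup>2" for x
      using z[of x] z[of "A x"] sa[of x "A x"]
      by (simp add: A.add inner_add power2_norm_eq_inner)
    then have "A x = 0" for x using z[of "x + A x"] by simp
    then show ?thesis
      by (intro op_eqI) (simp add: A_def op_apply_diff)
  qed
qed

end

section \<open>Von Neumann algebras with a tracial state\<close>

definition commutant :: "'a::chilbert_space bounded_op set \<Rightarrow> 'a bounded_op set" where
  "commutant X = {T. \<forall>S\<in>X. S * T = T * S}"

definition von_neumann_algebra :: "'a::chilbert_space bounded_op set \<Rightarrow> bool" where
  "von_neumann_algebra M \<longleftrightarrow> (\<forall>T\<in>M. adj T \<in> M) \<and> commutant (commutant M) = M"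

definition generated_vna :: "'a::chilbert_space bounded_op \<Rightarrow> 'a bounded_op set" where
  "generated_vna T = \<Inter>{N. von_neumann_algebra N \<and> T \<in> N}"

definition state_on :: "'a::chilbert_space bounded_op set \<Rightarrow> ('a bounded_op \<Rightarrow> complex) \<Rightarrow> bool"
  where "state_on M \<tau> \<longleftrightarrow>
    (\<forall>S\<in>M. \<forall>T\<in>M. \<tau> (S + T) = \<tau> S + \<tau> T) \<and>
    (\<forall>c. \<forall>T\<in>M. \<tau> (c *\<^sub>C T) = c * \<tau> T) \<and>
    (\<forall>T\<in>M. 0 \<le> T \<longrightarrow> \<tau> T \<in> \<real>\<^sub>\<ge>\<^sub>0) \<and>
    \<tau> 1 = 1"

text \<open>Normality is preservation of suprema of bounded upward directed sets of self-adjoint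
  elements.\<close>

definition normal_on :: "'a::chilbert_space bounded_op set \<Rightarrow> ('a bounded_op \<Rightarrow> complex) \<Rightarrow> bool"
  where "normal_on M \<tau> \<longleftrightarrow>
    (\<forall>D T. D \<subseteq> {S \<in> M. adj S = S} \<and> D \<noteq> {} \<and> (\<forall>P\<in>D. \<forall>Q\<in>D. \<exists>R\<in>D. P \<le> R \<and> Q \<le> R) \<and>
      T \<in> M \<and> (\<forall>S\<in>D. S \<le> T) \<and> (\<forall>R\<in>M. (\<forall>S\<in>D. S \<le> R) \<longrightarrow> T \<le> R) \<longrightarrow>
      Re (\<tau> T) = (SUP S\<in>D. Re (\<tau> S)))"

definition faithful_on :: "'a::chilbert_space bounded_op set \<Rightarrow> ('a bounded_op \<Rightarrow> complex) \<Rightarrow> bool"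
  where "faithful_on M \<tau> \<longleftrightarrow> (\<forall>T\<in>M. 0 \<le> T \<and> \<tau> T = 0 \<longrightarrow> T = 0)"

definition tracial_on :: "'a::chilbert_space bounded_op set \<Rightarrow> ('a bounded_op \<Rightarrow> complex) \<Rightarrow> bool"
  where "tracial_on M \<tau> \<longleftrightarrow> (\<forall>S\<in>M. \<forall>T\<in>M. \<tau> (S * T) = \<tau> (T * S))"

text \<open>A word \<open>c\<^sub>1 \<cdots> c\<^sub>m\<close> is encoded as the list of the pairs \<open>(i\<^sub>k, c\<^sub>k)\<close>, where \<open>i\<^sub>k\<close> names the
  subalgebra from which \<open>c\<^sub>k\<close> is taken. Subalgebras are distinguished by their index, so that a
  free family with a repeated subalgebra is not admitted unless that subalgebra is trivial.\<close>

definition freely_independent ::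
  "('a::chilbert_space bounded_op \<Rightarrow> complex) \<Rightarrow> 'i set \<Rightarrow> ('i \<Rightarrow> 'a bounded_op) \<Rightarrow> bool"
  where "freely_independent \<tau> I X \<longleftrightarrow>
    (\<forall>w. w \<noteq> [] \<and> (\<forall>(i, c) \<in> set w. i \<in> I \<and> c \<in> generated_vna (X i) \<and> \<tau> c = 0) \<and>
      successively (\<lambda>p q. fst p \<noteq> fst q) w \<longrightarrow>
      \<tau> (prod_list (map snd w)) = 0)"

section \<open>The two averages\<close>

definition word3 :: "(nat \<Rightarrow> 'a::chilbert_space bounded_op) \<Rightarrow> nat \<Rightarrow> nat \<Rightarrow> nat \<Rightarrow> 'a bounded_op"
  where "word3 b i j k = b i * b j * b k * adj (b k) * adj (b j) * adj (b i)"

definition E_wo3 :: "nat \<Rightarrow> (nat \<Rightarrow> 'a::chilbert_space bounded_op) \<Rightarrow> 'a bounded_op" where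
  "E_wo3 n b = (1 / (real n * (real n - 1) * (real n - 2))) *\<^sub>R
    (\<Sum>(i, j, k) \<in> {(i, j, k). {i, j, k} \<subseteq> {1..n} \<and> i \<noteq> j \<and> i \<noteq> k \<and> j \<noteq> k}. word3 b i j k)"

definition E_wr3 :: "nat \<Rightarrow> (nat \<Rightarrow> 'a::chilbert_space bounded_op) \<Rightarrow> 'a bounded_op" where
  "E_wr3 n b = (1 / real n ^ 3) *\<^sub>R (\<Sum>i=1..n. \<Sum>j=1..n. \<Sum>k=1..n. word3 b i j k)"

end

theory Submission
  imports Defs
begin

text \<open>
  Since \<open>u\<^sub>k\<close> is unitary, \<open>a\<^sub>k a\<^sub>k\<^sup>* = a\<^sup>2\<close>, so \<open>a\<^sub>i a\<^sub>j a\<^sub>k a\<^sub>k\<^sup>* a\<^sub>j\<^sup>* a\<^sub>i\<^sup>*\<close> does not depend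
  on \<open>k\<close>. Writing \<open>a\<^sup>2 = 1 + b\<close> in its centre, where \<open>b\<close> is a centred element of the algebra of \<open>a\<close>,
  splits it as \<open>P\<^sub>i + V\<^sub>i\<^sub>j\<close> with \<open>P\<^sub>i = a u\<^sub>i a\<^sup>2 u\<^sub>i\<^sup>* a\<close>
  and \<open>V\<^sub>i\<^sub>j = a u\<^sub>i a u\<^sub>j b u\<^sub>j\<^sup>* a u\<^sub>i\<^sup>* a\<close>.
  The terms \<open>P\<^sub>i\<close> have the same mean under both averages. Hence the gap
  \<open>G = E\<^sub>w\<^sub>r - E\<^sub>w\<^sub>o\<close> is a linear combination of the \<open>V\<^sub>i\<^sub>j\<close>, in which the
  diagonal ones have coefficient \<open>1/n\<^sup>2\<close> because only sampling with replacement produces them.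

  Freeness gives \<open>\<tau>(V\<^sub>i\<^sub>j) = 0\<close> for all \<open>i, j\<close> (\<open>trace_V\<close>), so \<open>\<tau>(G) = 0\<close>. If \<open>G \<ge> 0\<close>,
  faithfulness forces \<open>G = 0\<close>. But \<open>G\<close> has a nonzero component along \<open>V\<^sub>1\<^sub>1\<close>: freeness also gives
  \<open>\<tau>(V\<^sub>i\<^sub>j V\<^sub>1\<^sub>1) = 0\<close> unless \<open>i = j = 1\<close>, where the value is \<open>\<beta> = \<tau>(b\<^sup>2)\<close> (\<open>trace_V_V\<close>), so
  \<open>\<tau>(G V\<^sub>1\<^sub>1) = \<beta>/n\<^sup>2\<close> (\<open>functional_average_gap\<close>). Thus \<open>\<tau>(b\<^sup>2) = 0\<close>, hence \<open>b = 0\<close> and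
  \<open>a\<^sup>2 = 1\<close>, which is excluded.
\<close>

section \<open>The algebra of bounded operators\<close>

lemma op_apply_one: "op_apply 1 x = x"
  and op_apply_mult: "op_apply (S * T) x = op_apply S (op_apply T x)"
  and op_apply_scaleC_left: "op_apply (c *\<^sub>C T) x = c *\<^sub>C op_apply T x"
  by (transfer; simp)+

lemma scaleC_mult_left: "c *\<^sub>C S * T = c *\<^sub>C (S * T)" for S T :: "'h::chilbert_space bounded_op"
  by (rule op_eqI) (simp add: op_apply_mult op_apply_scaleC_left)

lemma scaleC_mult_right: "S * c *\<^sub>C T = c *\<^sub>C (S * T)" for S T :: "'h::chilbert_space bounded_op"
  by (rule op_eqI) (simp add: op_apply_mult op_apply_scaleC_left op_apply_scaleC)

lemma cinner_adj_right: "cinner x (op_apply (adj T) y) = cinner (op_apply T x) y"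
  by (metis cinner_adj cinner_commute)

lemma adj_mult: "adj (S * T) = adj T * adj S"
  by (intro op_eqI cinner_eqI) (simp add: cinner_adj op_apply_mult)

lemma adj_adj: "adj (adj T) = T"
  by (intro op_eqI cinner_eqI) (simp add: cinner_adj cinner_adj_right)

lemma adj_one: "adj 1 = 1"
  by (intro op_eqI cinner_eqI) (simp add: cinner_adj op_apply_one)

lemma adj_scaleC: "adj (c *\<^sub>C T) = cnj c *\<^sub>C adj T"
  by (intro op_eqI cinner_eqI)
     (simp add: cinner_adj op_apply_scaleC_left cinner_scaleC_left cinner_scaleC_right)

lemma adj_diff: "adj (S - T) = adj S - adj T"
  using adj_add[of "S - T" T] by (simp add: algebra_simps)

lemma adj_mult_self_nonneg: "0 \<le> adj T * T"
  by (simp add: less_eq_bounded_op_def positive_op_def adj_mult adj_adj op_apply_mult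
      cinner_adj_right Re_cinner)

lemma adj_mult_self_eq_0D:
  assumes "adj T * T = 0"
  shows "T = 0"
proof (rule op_eqI)
  fix x
  have "inner (op_apply T x) (op_apply T x) = Re (cinner x (op_apply (adj T * T) x))"
    by (simp only: op_apply_mult cinner_adj_right Re_cinner)
  also have "\<dots> = 0"
    by (simp only: assms op_apply_zero Re_cinner inner_zero_right)
  finally show "op_apply T x = op_apply 0 x"
    by (simp add: op_apply_zero)
qed

section \<open>Von Neumann algebras are unital *-algebras\<close>

context
  fixes N :: "'h::chilbert_space bounded_op set"
  assumes N: "von_neumann_algebra N"
begin

text \<open>Closure under the algebraic operations holds because a commutant is an algebra, so that membership
  in the double commutant can be tested one operator of the commutant at a time.\<close>

lemma vna_mem_iff: "T \<in> N \<longleftrightarrow> (\<forall>S \<in> commutant N. S * T = T * S)"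
  using N unfolding von_neumann_algebra_def commutant_def by blast

lemma vna_one: "1 \<in> N"
  by (simp add: vna_mem_iff)

lemma vna_add: "S \<in> N \<Longrightarrow> T \<in> N \<Longrightarrow> S + T \<in> N"
  by (simp add: vna_mem_iff distrib_left distrib_right)

lemma vna_scaleC: "T \<in> N \<Longrightarrow> c *\<^sub>C T \<in> N"
  by (simp add: vna_mem_iff scaleC_mult_left scaleC_mult_right)

lemma vna_mult: "S \<in> N \<Longrightarrow> T \<in> N \<Longrightarrow> S * T \<in> N"
  unfolding vna_mem_iff by (metis mult.assoc)

lemma vna_adj: "T \<in> N \<Longrightarrow> adj T \<in> N"
  using N by (simp add: von_neumann_algebra_def)

lemma vna_diff: "S \<in> N \<Longrightarrow> T \<in> N \<Longrightarrow> S - T \<in> N"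
  by (simp add: vna_mem_iff left_diff_distrib right_diff_distrib)

lemma vna_zero: "0 \<in> N"
  using vna_diff[OF vna_one vna_one] by simp

lemma generated_vna_subset: "T \<in> N \<Longrightarrow> generated_vna T \<subseteq> N"
  using N by (auto simp: generated_vna_def)

end

lemma generated_vna_self: "T \<in> generated_vna T"
  and generated_vna_adj: "S \<in> generated_vna T \<Longrightarrow> adj S \<in> generated_vna T"
  and generated_vna_one: "1 \<in> generated_vna T"
  and generated_vna_scaleC: "S \<in> generated_vna T \<Longrightarrow> c *\<^sub>C S \<in> generated_vna T"
  by (auto simp: generated_vna_def vna_adj vna_one vna_scaleC)

lemma generated_vna_mult: "S \<in> generated_vna T \<Longrightarrow> S' \<in> generated_vna T \<Longrightarrow> S * S' \<in> generated_vna T"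
  and generated_vna_diff: "S \<in> generated_vna T \<Longrightarrow> S' \<in> generated_vna T \<Longrightarrow> S - S' \<in> generated_vna T"
  by (auto simp: generated_vna_def vna_mult vna_diff)

section \<open>Faithful tracial states\<close>

locale tracial_vna =
  fixes M :: "'h::chilbert_space bounded_op set" and \<tau> :: "'h bounded_op \<Rightarrow> complex"
  assumes M: "von_neumann_algebra M"
    and state: "state_on M \<tau>" and faithful: "faithful_on M \<tau>" and tracial: "tracial_on M \<tau>"
begin

lemmas M_closed [simp, intro] =
  vna_one[OF M] vna_zero[OF M] vna_add[OF M] vna_diff[OF M] vna_mult[OF M] vna_scaleC[OF M]
  vna_adj[OF M]

lemma trace_add: "S \<in> M \<Longrightarrow> T \<in> M \<Longrightarrow> \<tau> (S + T) = \<tau> S + \<tau> T"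
  and trace_scaleC: "T \<in> M \<Longrightarrow> \<tau> (c *\<^sub>C T) = c * \<tau> T"
  and trace_one: "\<tau> 1 = 1"
  and trace_nonneg: "T \<in> M \<Longrightarrow> 0 \<le> T \<Longrightarrow> \<tau> T \<in> \<real>\<^sub>\<ge>\<^sub>0"
  using state by (simp_all add: state_on_def)

lemma trace_diff: "S \<in> M \<Longrightarrow> T \<in> M \<Longrightarrow> \<tau> (S - T) = \<tau> S - \<tau> T"
  using trace_add[of "S - T" T] by simp

lemma trace_zero: "\<tau> 0 = 0"
  using trace_diff[of 1 1] by simp

lemma trace_commute: "S \<in> M \<Longrightarrow> T \<in> M \<Longrightarrow> \<tau> (S * T) = \<tau> (T * S)"
  using tracial by (simp add: tracial_on_def)

text \<open>A self-adjoint operator is a combination of two squares,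
  \<open>4 S = (S + 1)\<^sup>2 - (S - 1)\<^sup>2\<close>, on each of which positivity of the state applies.\<close>

lemma trace_self_adjoint_real:
  assumes "S \<in> M" "adj S = S"
  shows "\<tau> S \<in> \<real>"
proof -
  have sq: "\<tau> (T * T) \<in> \<real>" if "T \<in> M" "adj T = T" for T
    using trace_nonneg[of "T * T"] adj_mult_self_nonneg[of T] that
    by (auto elim: nonneg_Reals_cases)
  have "4 *\<^sub>C S = (S + 1) * (S + 1) - (S - 1) * (S - 1)"
    using scaleC_add_left[of 2 2 S] scaleC_add_left[of 1 1 S] by (simp add: algebra_simps scaleC_one)
  then have "4 * \<tau> S = \<tau> ((S + 1) * (S + 1)) - \<tau> ((S - 1) * (S - 1))"
    using assms by (simp add: trace_diff flip: trace_scaleC)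
  then have "4 * \<tau> S \<in> \<real>"
    using assms by (simp add: sq adj_add adj_diff adj_one)
  then show ?thesis by (simp add: complex_is_Real_iff)
qed

text \<open>This makes the adjoint of each \<open>u\<^sub>j\<close> a centred element, hence usable in a free word.\<close>

lemma trace_adj_eq_0:
  assumes "T \<in> M" "\<tau> T = 0"
  shows "\<tau> (adj T) = 0"
proof -
  \<comment> \<open>Both \<open>T + T\<^sup>*\<close> and \<open>i (T\<^sup>* - T)\<close> are self-adjoint, so, as \<open>\<tau>(T) = 0\<close>,
    \<open>\<tau>(T\<^sup>*)\<close> and \<open>i \<tau>(T\<^sup>*)\<close> are both real.\<close>
  have "\<tau> (T + adj T) \<in> \<real>"
    using assms by (intro trace_self_adjoint_real) (auto simp: adj_add adj_adj add.commute)
  moreover have "\<tau> (\<i> *\<^sub>C (adj T - T)) \<in> \<real>"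
    using assms
    by (intro trace_self_adjoint_real)
       (auto simp: adj_scaleC adj_diff adj_adj, metis minus_diff_eq scaleC_minus_one
          scaleC_scaleC mult_minus1_right)
  ultimately show ?thesis
    using assms by (simp add: trace_add trace_diff trace_scaleC complex_is_Real_iff complex_eq_iff)
qed

lemma eq_0_if_nonneg_trace_0: "T \<in> M \<Longrightarrow> 0 \<le> T \<Longrightarrow> \<tau> T = 0 \<Longrightarrow> T = 0"
  using faithful by (simp add: faithful_on_def)

lemma trace_square_eq_0D: "T \<in> M \<Longrightarrow> adj T = T \<Longrightarrow> \<tau> (T * T) = 0 \<Longrightarrow> T = 0"
  using eq_0_if_nonneg_trace_0[of "T * T"] adj_mult_self_nonneg[of T] adj_mult_self_eq_0D[of T]
  by simp

section \<open>Averages over triples\<close>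

lemma sum_in_M: "(\<And>x. x \<in> A \<Longrightarrow> f x \<in> M) \<Longrightarrow> sum f A \<in> M"
  by (induction A rule: infinite_finite_induct) auto

context
  fixes n :: nat and x :: "nat \<Rightarrow> 'h bounded_op"
  assumes mem: "\<And>j. j \<in> {1..n} \<Longrightarrow> x j \<in> M"
begin

lemma word3_in_M: "i \<in> {1..n} \<Longrightarrow> j \<in> {1..n} \<Longrightarrow> k \<in> {1..n} \<Longrightarrow> word3 x i j k \<in> M"
  using mem by (auto simp: word3_def)

lemma sum_distinct_in_M:
  "(\<Sum>(i, j, k) \<in> {(i, j, k). {i, j, k} \<subseteq> {1..n} \<and> i \<noteq> j \<and> i \<noteq> k \<and> j \<noteq> k}. word3 x i j k) \<in> M"
  by (intro sum_in_M) (auto intro: word3_in_M)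

lemma sum_all_in_M: "(\<Sum>i=1..n. \<Sum>j=1..n. \<Sum>k=1..n. word3 x i j k) \<in> M"
  by (intro sum_in_M word3_in_M)

lemma averages_diff_in_M: "E_wr3 n x - E_wo3 n x \<in> M"
  using sum_distinct_in_M sum_all_in_M by (auto simp: E_wo3_def E_wr3_def scaleR_scaleC)

end

context
  fixes F :: "'h bounded_op \<Rightarrow> complex"
  assumes add: "\<And>S T. S \<in> M \<Longrightarrow> T \<in> M \<Longrightarrow> F (S + T) = F S + F T"
    and scale: "\<And>c T. T \<in> M \<Longrightarrow> F (c *\<^sub>C T) = c * F T"
begin

lemma functional_diff: "S \<in> M \<Longrightarrow> T \<in> M \<Longrightarrow> F (S - T) = F S - F T"
  using add[of "S - T" T] by simp

lemma functional_sum: "(\<And>x. x \<in> A \<Longrightarrow> f x \<in> M) \<Longrightarrow> F (sum f A) = (\<Sum>x\<in>A. F (f x))"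
proof (induction A rule: infinite_finite_induct)
  case (insert x A)
  then show ?case by (simp add: add sum_in_M)
qed (use functional_diff[of 1 1] in simp_all)

text \<open>The value of \<open>F\<close> on a word is a part \<open>q i\<close> depending on the first index only plus a bump
  \<open>\<beta>\<close> on the diagonal pair \<open>(r, r)\<close>. Both averages give each value of the first index the weight
  \<open>1/n\<close>, so \<open>q\<close> cancels. A triple with \<open>i = j = r\<close> never has distinct entries, and \<open>n\<close> of
  the \<open>n\<^sup>3\<close> unrestricted triples are of this kind, which leaves \<open>\<beta> n / n\<^sup>3\<close>.\<close>

lemma functional_average_gap:
  assumes n: "n \<ge> 3" and r: "r \<in> {1..n}"
    and mem: "\<And>j. j \<in> {1..n} \<Longrightarrow> x j \<in> M"
    and val: "\<And>i j k. i \<in> {1..n} \<Longrightarrow> j \<in> {1..n} \<Longrightarrow> k \<in> {1..n} \<Longrightarrow>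
      F (word3 x i j k) = q i + (if i = r \<and> j = r then \<beta> else 0)"
  shows "F (E_wr3 n x - E_wo3 n x) = \<beta> / of_nat n ^ 2"
proof -
  let ?I = "{1..n}"
  let ?D = "{(i, j, k). {i, j, k} \<subseteq> ?I \<and> i \<noteq> j \<and> i \<noteq> k \<and> j \<noteq> k}"
  have D: "?D = (SIGMA i:?I. SIGMA j:?I - {i}. ?I - {i, j})" by auto
  note word = word3_in_M[OF mem] and woM = sum_distinct_in_M[OF mem] and wrM = sum_all_in_M[OF mem]
  have n0: "(of_nat n :: complex) \<noteq> 0" using n by simp
  have n1: "(of_nat n - 1 :: complex) \<noteq> 0" using n
    using of_nat_eq_iff[of n 1, where 'a = complex] by simp
  have n2: "(of_nat n - 2 :: complex) \<noteq> 0"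
    using n of_nat_eq_iff[of n 2, where 'a = complex] by simp
  have "F (\<Sum>(i, j, k)\<in>?D. word3 x i j k) = (\<Sum>(i, j, k)\<in>?D. F (word3 x i j k))"
    by (subst functional_sum) (auto intro: word simp: case_prod_unfold)
  also have "\<dots> = (\<Sum>i\<in>?I. \<Sum>j\<in>?I - {i}. \<Sum>k\<in>?I - {i, j}. F (word3 x i j k))"
    unfolding D by (simp add: sum.Sigma)
  also have "\<dots> = (\<Sum>i\<in>?I. \<Sum>j\<in>?I - {i}. \<Sum>k\<in>?I - {i, j}. q i)"
    by (intro sum.cong refl) (subst val, auto)
  also have "\<dots> = (\<Sum>i\<in>?I. of_nat (n - 1) * (of_nat (n - 2) * q i))"
    by (intro sum.cong refl) (auto simp: card_Diff_subset card_insert_if)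
  also have "\<dots> = (of_nat n - 1) * (of_nat n - 2) * (\<Sum>i\<in>?I. q i)"
    using n by (simp add: of_nat_diff sum_distrib_left mult.assoc)
  finally have wo: "F (E_wo3 n x) = (\<Sum>i\<in>?I. q i) / of_nat n"
    using woM n0 n1 n2 by (simp add: E_wo3_def scaleR_scaleC scale)
  have "F (\<Sum>i=1..n. \<Sum>j=1..n. \<Sum>k=1..n. word3 x i j k)
      = (\<Sum>i=1..n. \<Sum>j=1..n. \<Sum>k=1..n. F (word3 x i j k))"
    by (simp only: functional_sum sum_in_M word cong: sum.cong)
  also have "\<dots> = (\<Sum>i=1..n. \<Sum>j=1..n. \<Sum>k=1..n. q i + (if i = r \<and> j = r then \<beta> else 0))"
    by (intro sum.cong refl val)
  also have "\<dots> = (\<Sum>i=1..n. of_nat n * (of_nat n * q i) + (if i = r then of_nat n * \<beta> else 0))"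
  proof (intro sum.cong refl)
    fix i
    show "(\<Sum>j=1..n. \<Sum>k=1..n. q i + (if i = r \<and> j = r then \<beta> else 0))
        = of_nat n * (of_nat n * q i) + (if i = r then of_nat n * \<beta> else 0)"
    proof (cases "i = r")
      case True
      have "(\<Sum>j=1..n. \<Sum>k=1..n. q i + (if i = r \<and> j = r then \<beta> else 0))
          = (\<Sum>j\<in>?I. of_nat n * q i + (if j = r then of_nat n * \<beta> else 0))"
        using True by (intro sum.cong refl) (simp add: distrib_left)
      also have "\<dots> = of_nat n * (of_nat n * q i) + of_nat n * \<beta>"
        using r by (simp only: sum.distrib sum.delta finite_atLeastAtMost sum_constant card_atLeastAtMost) simp
      finally show ?thesis using True by simp
    qed simp
  qed
  also have "\<dots> = of_nat n * (of_nat n * (\<Sum>i=1..n. q i)) + of_nat n * \<beta>"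
    using r by (simp add: sum.distrib sum_distrib_left)
  finally have wr: "F (E_wr3 n x) = (\<Sum>i\<in>?I. q i) / of_nat n + \<beta> / of_nat n ^ 2"
    using wrM n0 by (simp add: E_wr3_def scaleR_scaleC scale field_simps power2_eq_square power3_eq_cube)
  show "F (E_wr3 n x - E_wo3 n x) = \<beta> / of_nat n ^ 2"
    using woM wrM wo wr
    by (subst functional_diff) (auto simp: E_wo3_def E_wr3_def scaleR_scaleC)
qed

end

end

section \<open>Free words\<close>

locale free_words = tracial_vna M \<tau>
  for M :: "'h::chilbert_space bounded_op set" and \<tau> :: "'h bounded_op \<Rightarrow> complex" +
  fixes n :: nat and u :: "nat \<Rightarrow> 'h bounded_op" and a :: "'h bounded_op"
  assumes u: "\<And>j. j \<in> {1..n} \<Longrightarrow> u j \<in> M \<and> unitary_op (u j)"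
    and a_M: "a \<in> M" and a_adj: "adj a = a"
    and free: "freely_independent \<tau> {0..n} (\<lambda>j. if j = 0 then a else u j)"
    and trace_u: "\<And>j. j \<in> {1..n} \<Longrightarrow> \<tau> (u j) = 0"
    and trace_a: "\<tau> a = 0" and trace_aa: "\<tau> (a * a) = 1"
begin

text \<open>The operators \<open>b\<close> and \<open>c\<close> are the centred parts of \<open>a\<^sup>2\<close> and \<open>b\<^sup>2\<close>.\<close>

definition b :: "'h bounded_op" where "b = a * a - 1"

definition \<beta> :: complex where "\<beta> = \<tau> (b * b)"

definition c :: "'h bounded_op" where "c = b * b - \<beta> *\<^sub>C 1"

definition letter :: "nat \<times> 'h bounded_op \<Rightarrow> bool" where
  "letter p \<longleftrightarrow> fst p \<in> {0..n} \<and>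
    snd p \<in> generated_vna (if fst p = 0 then a else u (fst p)) \<and> \<tau> (snd p) = 0"

lemma abc_gen: "a \<in> generated_vna a" "b \<in> generated_vna a" "c \<in> generated_vna a"
  by (simp_all add: b_def c_def generated_vna_self generated_vna_mult generated_vna_diff
      generated_vna_one generated_vna_scaleC)

lemma abc_M [simp]: "a \<in> M" "b \<in> M" "c \<in> M"
  using abc_gen generated_vna_subset[OF M a_M] by auto

lemma u_M [simp]: "j \<in> {1..n} \<Longrightarrow> u j \<in> M"
  using u by blast

lemma letters [simp]:
  "letter (0, a)" "letter (0, b)" "letter (0, c)"
  "j \<in> {1..n} \<Longrightarrow> letter (j, u j)" "j \<in> {1..n} \<Longrightarrow> letter (j, adj (u j))"
  using abc_gen
  by (auto simp: letter_def trace_a trace_u trace_adj_eq_0 generated_vna_self generated_vna_adj)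
     (simp_all add: b_def c_def trace_diff trace_scaleC trace_one trace_aa \<beta>_def)

text \<open>The only use of freeness: once a product has been written in letters, each of its terms whose
  letters come from alternating algebras has trace zero.\<close>

lemma trace_word:
  assumes "w \<noteq> []" "\<forall>p \<in> set w. letter p" "successively (\<lambda>p q. fst p \<noteq> fst q) w"
  shows "\<tau> (prod_list (map snd w)) = 0"
  using free assms unfolding freely_independent_def letter_def by fastforce

lemma aa: "a * a = 1 + b" "a * (a * x) = x + b * x"
  by (simp_all add: b_def left_diff_distrib mult.assoc)

lemma bb: "b * b = \<beta> *\<^sub>C 1 + c" "b * (b * x) = \<beta> *\<^sub>C x + c * x"
  by (simp_all add: c_def left_diff_distrib mult.assoc scaleC_mult_left)

lemma uu:
  assumes "j \<in> {1..n}"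
  shows "u j * adj (u j) = 1" "adj (u j) * u j = 1" "u j * (adj (u j) * x) = x" "adj (u j) * (u j * x) = x"
  using u[OF assms] by (simp_all add: unitary_op_def flip: mult.assoc)

text \<open>Rewriting with \<open>a\<^sup>2 = 1 + b\<close>, \<open>b\<^sup>2 = \<beta> + c\<close> and the cancellation of each unitary against its adjoint
  turns a product of letters into a combination of shorter or alternating words.\<close>

lemmas reduce = aa bb uu distrib_left distrib_right scaleC_add_right scaleC_mult_left
  scaleC_mult_right mult.assoc trace_add trace_scaleC

text \<open>The alternating word inside \<open>V\<close>. The outer factors \<open>a\<close> of \<open>V\<close> are kept apart, since under the
  trace they merge with their neighbours into \<open>a\<^sup>2 = 1 + b\<close>.\<close>

definition core :: "nat \<Rightarrow> nat \<Rightarrow> 'h bounded_op" where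
  "core i j = u i * a * u j * b * adj (u j) * a * adj (u i)"

definition V :: "nat \<Rightarrow> nat \<Rightarrow> 'h bounded_op" where
  "V i j = a * core i j * a"

lemma core_M [simp]: "i \<in> {1..n} \<Longrightarrow> j \<in> {1..n} \<Longrightarrow> core i j \<in> M"
  by (simp add: core_def)

lemma V_M [simp]: "i \<in> {1..n} \<Longrightarrow> j \<in> {1..n} \<Longrightarrow> V i j \<in> M"
  by (simp add: V_def)

text \<open>The right-hand side is free of \<open>k\<close> because \<open>u\<^sub>k\<close> cancels against its adjoint; its first
  summand is also free of \<open>j\<close>, because there the factor \<open>a\<^sup>2\<close> next to \<open>u\<^sub>j\<close> has been replaced by its
  mean \<open>1\<close>.\<close>

lemma word3_eq:
  assumes "i \<in> {1..n}" "j \<in> {1..n}" "k \<in> {1..n}"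
  shows "word3 (\<lambda>j. a * u j) i j k = a * u i * a * a * adj (u i) * a + V i j"
proof -
  have "word3 (\<lambda>j. a * u j) i j k = a * u i * a * u j * (a * a) * adj (u j) * a * adj (u i) * a"
    using assms by (simp add: word3_def adj_mult a_adj mult.assoc uu)
  also have "\<dots> = a * u i * a * a * adj (u i) * a + V i j"
    using assms by (simp only: aa(1)) (simp add: V_def core_def distrib_left distrib_right mult.assoc uu)
  finally show ?thesis .
qed

text \<open>Rotated together, the outer letters become \<open>a\<^sup>2 = 1 + b\<close>, and \<open>core i j\<close> alternates with and
  without a leading \<open>b\<close>, even for \<open>i = j\<close>.\<close>

lemma trace_V:
  assumes "i \<in> {1..n}" "j \<in> {1..n}"
  shows "\<tau> (V i j) = 0"
proof -
  have "\<tau> (V i j) = \<tau> (a * a * core i j)"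
    using assms trace_commute[of "a * core i j" a] by (simp add: V_def mult.assoc)
  also have "\<dots> = \<tau> (core i j) + \<tau> (b * core i j)"
    using assms by (simp add: aa distrib_right trace_add)
  also have "\<tau> (core i j) = 0"
    using assms trace_word[of "[(i, u i), (0, a), (j, u j), (0, b), (j, adj (u j)), (0, a), (i, adj (u i))]"]
    by (simp add: core_def mult.assoc)
  also have "\<tau> (b * core i j) = 0"
    using assms trace_word[of "[(0, b), (i, u i), (0, a), (j, u j), (0, b), (j, adj (u j)), (0, a), (i, adj (u i))]"]
    by (simp add: core_def mult.assoc)
  finally show ?thesis by simp
qed

text \<open>For \<open>i \<noteq> r\<close> the product is already alternating. For \<open>i = r\<close> the inner pair \<open>u\<^sub>r\<^sup>* u\<^sub>r\<close> cancels, and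
  rotating \<open>u\<^sub>r a\<close> to the back produces two factors \<open>a\<^sup>2\<close> separating \<open>u\<^sub>j b u\<^sub>j\<^sup>*\<close> from
  \<open>u\<^sub>r b u\<^sub>r\<^sup>*\<close>. Of the four terms obtained from \<open>a\<^sup>2 = 1 + b\<close>, only the one without an extra \<open>b\<close> can
  have a nonzero trace. For \<open>j = r\<close> it is a conjugate of \<open>b\<^sup>2\<close>, and for \<open>j \<noteq> r\<close> it alternates.\<close>

lemma trace_core_core:
  assumes i: "i \<in> {1..n}" and j: "j \<in> {1..n}" and r: "r \<in> {1..n}"
  shows "\<tau> (core i j * core r r) = (if i = r \<and> j = r then \<beta> else 0)"
proof (cases "i = r")
  case False
  then show ?thesis
    using assms trace_word[of "[(i, u i), (0, a), (j, u j), (0, b), (j, adj (u j)), (0, a), (i, adj (u i)),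
      (r, u r), (0, a), (r, u r), (0, b), (r, adj (u r)), (0, a), (r, adj (u r))]"]
    by (simp add: core_def mult.assoc)
next
  case True
  let ?A = "u j * (b * adj (u j))" and ?B = "u r * (b * adj (u r))"
  have "core i j * core r r = (u r * a) * (?A * a * a * ?B * a * adj (u r))"
    using True r by (simp add: core_def mult.assoc uu)
  then have "\<tau> (core i j * core r r) = \<tau> ((?A * a * a * ?B * a * adj (u r)) * (u r * a))"
    using j r by (simp only: trace_commute[of "u r * a"] M_closed u_M abc_M)
  also have "\<dots> = \<tau> (?A * ?B + ?A * b * ?B + ?A * ?B * b + ?A * b * ?B * b)"
    using r by (simp add: uu aa mult.assoc distrib_left distrib_right add.assoc add.left_commute)
  also have "\<dots> = \<tau> (?A * ?B) + \<tau> (?A * b * ?B) + \<tau> (?A * ?B * b) + \<tau> (?A * b * ?B * b)"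
    using j r by (simp add: trace_add)
  also have "\<tau> (?A * b * ?B) = 0"
    using j r trace_word[of "[(j, u j), (0, b), (j, adj (u j)), (0, b), (r, u r), (0, b), (r, adj (u r))]"]
    by (simp add: mult.assoc)
  also have "\<tau> (?A * b * ?B * b) = 0"
    using j r trace_word[of "[(j, u j), (0, b), (j, adj (u j)), (0, b), (r, u r), (0, b), (r, adj (u r)), (0, b)]"]
    by (simp add: mult.assoc)
  also have "\<tau> (?A * ?B) = (if j = r then \<beta> else 0)"
  proof (cases "j = r")
    case True
    then show ?thesis
      using r trace_word[of "[(r, u r), (0, c), (r, adj (u r))]"]
      by (simp add: reduce trace_one)
  next
    case False
    then show ?thesis
      using j r trace_word[of "[(j, u j), (0, b), (j, adj (u j)), (r, u r), (0, b), (r, adj (u r))]"]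
      by (simp add: mult.assoc)
  qed
  also have "\<tau> (?A * ?B * b) = 0"
  proof (cases "j = r")
    case True
    then show ?thesis
      using r trace_word[of "[(0, b)]"] trace_word[of "[(r, u r), (0, c), (r, adj (u r)), (0, b)]"]
      by (simp add: reduce)
  next
    case False
    then show ?thesis
      using j r trace_word[of "[(j, u j), (0, b), (j, adj (u j)), (r, u r), (0, b), (r, adj (u r)), (0, b)]"]
      by (simp add: mult.assoc)
  qed
  finally show ?thesis using True by simp
qed

text \<open>The leading \<open>b\<close> destroys the cyclic cancellation of \<open>u\<^sub>r\<close> that gave a nonzero value above.\<close>

lemma trace_b_core_core:
  assumes i: "i \<in> {1..n}" and j: "j \<in> {1..n}" and r: "r \<in> {1..n}"
  shows "\<tau> (b * core i j * core r r) = 0"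
proof (cases "i = r")
  case False
  then show ?thesis
    using assms trace_word[of "[(0, b), (i, u i), (0, a), (j, u j), (0, b), (j, adj (u j)), (0, a), (i, adj (u i)),
      (r, u r), (0, a), (r, u r), (0, b), (r, adj (u r)), (0, a), (r, adj (u r))]"]
    by (simp add: core_def mult.assoc)
next
  case True
  \<comment> \<open>The word arising from the \<open>b\<close> part of the \<open>a\<^sup>2\<close> that appears when \<open>u\<^sub>r\<^sup>* u\<^sub>r\<close> cancels; it
    alternates even for \<open>j = r\<close>.\<close>
  have long: "\<tau> (b * (u r * (a * (u j * (b * (adj (u j) * (b * (u r * (b * (adj (u r) * (a * adj (u r)))))))))))) = 0"
    using j r trace_word[of "[(0, b), (r, u r), (0, a), (j, u j), (0, b), (j, adj (u j)), (0, b),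
      (r, u r), (0, b), (r, adj (u r)), (0, a), (r, adj (u r))]"] by simp
  show ?thesis
  proof (cases "j = r")
    case False
    then show ?thesis
      using True j r long trace_word[of "[(0, b), (r, u r), (0, a), (j, u j), (0, b), (j, adj (u j)),
        (r, u r), (0, b), (r, adj (u r)), (0, a), (r, adj (u r))]"]
      by (simp add: core_def reduce)
  next
    case jr: True
    then show ?thesis
      using True r long trace_word[of "[(0, b)]"] trace_word[of "[(0, b), (r, u r), (0, b), (r, adj (u r))]"]
        trace_word[of "[(0, b), (r, u r), (0, a), (r, u r), (0, c), (r, adj (u r)), (0, a), (r, adj (u r))]"]
      by (simp add: core_def reduce)
  qed
qed

text \<open>Cyclicity brings the four outer letters \<open>a\<close> together in two pairs \<open>a\<^sup>2 = 1 + b\<close>. Every term that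
  retains a \<open>b\<close> has trace zero, so only the product of the two cores contributes.\<close>

lemma trace_V_V:
  assumes i: "i \<in> {1..n}" and j: "j \<in> {1..n}" and r: "r \<in> {1..n}"
  shows "\<tau> (V i j * V r r) = (if i = r \<and> j = r then \<beta> else 0)"
proof -
  have "\<tau> (V i j * V r r) = \<tau> (core i j * (a * a) * core r r * (a * a))"
    using assms trace_commute[of a "core i j * (a * a) * core r r * a"] by (simp add: V_def mult.assoc)
  also have "\<dots> = \<tau> (core i j * core r r) + \<tau> (core i j * core r r * b)
      + \<tau> (core i j * b * core r r) + \<tau> (core i j * b * core r r * b)"
    using assms by (simp add: aa distrib_left distrib_right trace_add mult.assoc)
  also have "\<tau> (core i j * core r r * b) = 0"
    using assms trace_commute[of b "core i j * core r r"] trace_b_core_core by (simp add: mult.assoc)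
  also have "\<tau> (core i j * b * core r r) = 0"
    using assms trace_word[of "[(i, u i), (0, a), (j, u j), (0, b), (j, adj (u j)), (0, a), (i, adj (u i)),
      (0, b), (r, u r), (0, a), (r, u r), (0, b), (r, adj (u r)), (0, a), (r, adj (u r))]"]
    by (simp add: core_def mult.assoc)
  also have "\<tau> (core i j * b * core r r * b) = 0"
    using assms trace_word[of "[(i, u i), (0, a), (j, u j), (0, b), (j, adj (u j)), (0, a), (i, adj (u i)),
      (0, b), (r, u r), (0, a), (r, u r), (0, b), (r, adj (u r)), (0, a), (r, adj (u r)), (0, b)]"]
    by (simp add: core_def mult.assoc)
  finally show ?thesis using assms by (simp add: trace_core_core)
qed

lemma not_E_wo3_le_E_wr3:
  assumes n: "n \<ge> 3" and aa1: "a * a \<noteq> 1"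
  shows "\<not> E_wo3 n (\<lambda>j. a * u j) \<le> E_wr3 n (\<lambda>j. a * u j)"
proof
  let ?x = "\<lambda>j. a * u j"
  let ?G = "E_wr3 n ?x - E_wo3 n ?x"
  let ?P = "\<lambda>i. a * u i * a * a * adj (u i) * a"
  assume "E_wo3 n ?x \<le> E_wr3 n ?x"
  then have "0 \<le> ?G" by (simp add: less_eq_bounded_op_def)
  have r: "1 \<in> {1..n}" using n by simp
  have x: "?x j \<in> M" if "j \<in> {1..n}" for j using that by simp
  have G_M: "?G \<in> M" using x by (rule averages_diff_in_M)
  have "\<tau> ?G = 0 / of_nat n ^ 2"
  proof (rule functional_average_gap[OF _ _ n r x])
    show "\<tau> (word3 ?x i j k) = \<tau> (?P i) + (if i = 1 \<and> j = 1 then 0 else 0)"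
      if "i \<in> {1..n}" "j \<in> {1..n}" "k \<in> {1..n}" for i j k
      using that by (simp only: word3_eq trace_add M_closed u_M abc_M V_M trace_V if_cancel)
  qed (simp_all only: trace_add trace_scaleC)
  \<comment> \<open>A positive element of trace zero vanishes, by faithfulness.\<close>
  then have "?G = 0"
    using eq_0_if_nonneg_trace_0[OF G_M \<open>0 \<le> ?G\<close>] by simp
  \<comment> \<open>Any diagonal \<open>V r r\<close> detects that the gap is nonzero; \<open>r = 1\<close> is one choice.\<close>
  moreover have "\<tau> (?G * V 1 1) = \<beta> / of_nat n ^ 2"
  proof (rule functional_average_gap[OF _ _ n r x, where F = "\<lambda>T. \<tau> (T * V 1 1)"])
    show "\<tau> (word3 ?x i j k * V 1 1) = \<tau> (?P i * V 1 1) + (if i = 1 \<and> j = 1 then \<beta> else 0)"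
      if "i \<in> {1..n}" "j \<in> {1..n}" "k \<in> {1..n}" for i j k
      using that r
      by (simp only: word3_eq distrib_right trace_add M_closed u_M abc_M V_M trace_V_V)
  qed (use r in \<open>simp_all only: trace_add trace_scaleC distrib_right scaleC_mult_left M_closed V_M\<close>)
  ultimately have "\<tau> (b * b) = 0"
    using n by (simp add: trace_zero \<beta>_def)
  then have "b = 0"
    by (intro trace_square_eq_0D) (simp_all add: b_def adj_diff adj_mult a_adj adj_one)
  then show False using aa1 by (simp add: b_def)
qed

end

theorem theorem3p2:
  fixes M :: "'h::chilbert_space bounded_op set"
    and \<tau> :: "'h bounded_op \<Rightarrow> complex"
    and n :: nat
    and u :: "nat \<Rightarrow> 'h bounded_op"
    and a :: "'h bounded_op"
  assumes "von_neumann_algebra M"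
    and "state_on M \<tau>" and "faithful_on M \<tau>" and "normal_on M \<tau>" and "tracial_on M \<tau>"
    and "n \<ge> 3"
    and "\<And>j. j \<in> {1..n} \<Longrightarrow> u j \<in> M \<and> unitary_op (u j)"
    and "a \<in> M" and "adj a = a"
    and "freely_independent \<tau> {0..n} (\<lambda>j. if j = 0 then a else u j)"
    and "\<And>j. j \<in> {1..n} \<Longrightarrow> \<tau> (u j) = 0"
    and "\<tau> a = 0" and "\<tau> (a * a) = 1" and "a * a \<noteq> 1"
  shows "\<not> E_wo3 n (\<lambda>j. a * u j) \<le> E_wr3 n (\<lambda>j. a * u j)"
proof -
  interpret free_words M \<tau> n u a
    by unfold_locales (use assms in auto)
  show ?thesis using assms by (intro not_E_wo3_le_E_wr3)
qed

end
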